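(* For every real number $\lambda>1$ and every positive integer $n$, $$d_{GH}\bigl(\mathbb{Z}^n,\;\lambda\mathbb{Z}^n\bigr)\ \ge\ \frac12.$$
   Context: $\mathbb{Z}^n\subset\mathbb{R}^n$ carries the metric induced from the Euclidean metric of $\mathbb{R}^n$. For a metric space $(X,d_X)$ and $\lambda>0$, $\lambda X$ denotes the metric space $(X,\lambda d_X)$. For metric spaces $X,Y$, $d_{GH}(X,Y)\in[0,\infty]$ is the Gromov--Hausdorff distance: the infimum of the numbers $r\ge 0$ such that there exist a metric space $Z$ and subsets $X',Y'\subset Z$ isometric to $X$ and $Y$ respectively with Hausdorff distance $d_H(X',Y')\le r$ (it may be infinite). Equivalently, $2d_{GH}(X,Y)=\inf\{\operatorname{dis}R\}$ over all correspondences $R\subset X\times Y$ (subsets projecting onto both factors), where $\operatorname{dis}R=\sup\{\,||xx'|-|yy'||:(x,y),(x',y')\in R\}$. *)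

theory Defs
  imports "HOL-Analysis.Analysis"
begin

definition isometric_metrics :: "'a metric \<Rightarrow> 'b metric \<Rightarrow> bool" where
  "isometric_metrics X Y \<longleftrightarrow>
     (\<exists>f. f ` mspace X = mspace Y \<and>
          (\<forall>x\<in>mspace X. \<forall>x'\<in>mspace X. mdist Y (f x) (f x') = mdist X x x'))"

definition Hausdorff_dist :: "'a metric \<Rightarrow> 'a set \<Rightarrow> 'a set \<Rightarrow> ennreal" where
  "Hausdorff_dist Z A B =
     max (SUP a\<in>A. INF b\<in>B. ennreal (mdist Z a b))
         (SUP b\<in>B. INF a\<in>A. ennreal (mdist Z a b))"

text \<open>
  The ambient space \<open>Z\<close> ranges over metric spaces whose points are taken from the type
  \<^typ>\<open>'a + 'b\<close>; its carrier may be any subset of that type. This is no restriction: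
  \<open>Z\<close> may be replaced by the union of the two isometric copies, which has at most as many
  points as the disjoint union of \<open>X\<close> and \<open>Y\<close>. See \<open>GH_dist_le_Hausdorff_dist\<close> below, where
  the type of \<open>Z\<close> is arbitrary. The infimum of the empty set is \<open>\<infinity>\<close>.
\<close>

definition GH_dist :: "'a metric \<Rightarrow> 'b metric \<Rightarrow> ennreal" where
  "GH_dist X Y =
     Inf {ennreal r | r. 0 \<le> r \<and>
       (\<exists>(Z :: ('a + 'b) metric) X' Y'.
          X' \<subseteq> mspace Z \<and> Y' \<subseteq> mspace Z \<and>
          isometric_metrics X (submetric Z X') \<and>
          isometric_metrics Y (submetric Z Y') \<and>
          Hausdorff_dist Z X' Y' \<le> ennreal r)}"

text \<open>Only meaningful for \<open>c > 0\<close>; see \<open>mspace_scale_metric\<close> and \<open>mdist_scale_metric\<close>.\<close>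

definition scale_metric :: "real \<Rightarrow> 'a metric \<Rightarrow> 'a metric" where
  "scale_metric c X = metric (mspace X, \<lambda>x y. c * mdist X x y)"

definition integer_lattice :: "(real ^ 'n) metric" where
  "integer_lattice = submetric euclidean_metric {x. \<forall>i. x $ i \<in> \<int>}"

lemma Metric_space_scale:
  assumes "c > 0"
  shows "Metric_space (mspace X) (\<lambda>x y. c * mdist X x y)"
proof
  fix x y z assume "x \<in> mspace X" "y \<in> mspace X" "z \<in> mspace X"
  then have "mdist X x z \<le> mdist X x y + mdist X y z"
    by (rule mdist_triangle)
  then show "c * mdist X x z \<le> c * mdist X x y + c * mdist X y z"
    using assms by (simp flip: distrib_left)
qed (use assms in \<open>auto simp: mdist_commute\<close>)

lemma mspace_scale_metric: "c > 0 \<Longrightarrow> mspace (scale_metric c X) = mspace X"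
  by (simp add: scale_metric_def Metric_space.mspace_metric Metric_space_scale)

lemma mdist_scale_metric: "c > 0 \<Longrightarrow> mdist (scale_metric c X) x y = c * mdist X x y"
  by (simp add: scale_metric_def Metric_space.mdist_metric Metric_space_scale)

lemma mspace_integer_lattice: "mspace integer_lattice = {x. \<forall>i. x $ i \<in> \<int>}"
  by (simp add: integer_lattice_def)

lemma mdist_integer_lattice: "mdist integer_lattice x y = dist x y"
  by (simp add: integer_lattice_def)

lemma GH_dist_le_Hausdorff_dist:
  fixes X :: "'a metric" and Y :: "'b metric" and Z :: "'c metric"
  assumes A: "A \<subseteq> mspace Z" and B: "B \<subseteq> mspace Z"
    and XA: "isometric_metrics X (submetric Z A)"
    and YB: "isometric_metrics Y (submetric Z B)"
  shows "GH_dist X Y \<le> Hausdorff_dist Z A B"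
proof (cases "Hausdorff_dist Z A B")
  case top
  then show ?thesis by simp
next
  case (real r)
  have ms: "mspace (submetric Z A) = A" "mspace (submetric Z B) = B"
    using A B by auto
  obtain f where f: "f ` mspace X = A"
      "\<And>x x'. x \<in> mspace X \<Longrightarrow> x' \<in> mspace X \<Longrightarrow> mdist Z (f x) (f x') = mdist X x x'"
    using XA unfolding isometric_metrics_def ms by auto
  obtain g where g: "g ` mspace Y = B"
      "\<And>x x'. x \<in> mspace Y \<Longrightarrow> x' \<in> mspace Y \<Longrightarrow> mdist Z (g x) (g x') = mdist Y x x'"
    using YB unfolding isometric_metrics_def ms by auto
  define h where "h z = (if z \<in> A then Inl (inv_into (mspace X) f z)
      else (Inr (inv_into (mspace Y) g z) :: 'a + 'b))" for z
  define k where "k = case_sum f g"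
  have kh: "k (h z) = z" if "z \<in> A \<union> B" for z
    using that f(1) g(1) by (auto simp: h_def k_def f_inv_into_f)
  define Z' where "Z' = metric (h ` (A \<union> B), \<lambda>p q. mdist Z (k p) (k q))"
  have MS: "Metric_space (h ` (A \<union> B)) (\<lambda>p q. mdist Z (k p) (k q))"
  proof
    fix p q w assume pqw: "p \<in> h ` (A \<union> B)" "q \<in> h ` (A \<union> B)"
    then have in_Z: "k p \<in> mspace Z" "k q \<in> mspace Z"
      using A B kh by auto
    show "mdist Z (k p) (k q) = 0 \<longleftrightarrow> p = q"
    proof
      assume "mdist Z (k p) (k q) = 0"
      then have "k p = k q" using in_Z by simp
      then show "p = q" using pqw kh by (metis imageE)
    qed (use in_Z in simp)
    assume "w \<in> h ` (A \<union> B)"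
    then have "k w \<in> mspace Z" using A B kh by auto
    with in_Z show "mdist Z (k p) (k w) \<le> mdist Z (k p) (k q) + mdist Z (k q) (k w)"
      by (simp add: mdist_triangle)
  qed (auto simp: mdist_commute)
  have Z': "mspace Z' = h ` (A \<union> B)" "mdist Z' p q = mdist Z (k p) (k q)" for p q
    by (simp_all add: Z'_def Metric_space.mspace_metric[OF MS] Metric_space.mdist_metric[OF MS])
  have iso1: "isometric_metrics X (submetric Z' (h ` A))"
    unfolding isometric_metrics_def
  proof (intro exI[of _ "h \<circ> f"] conjI ballI)
    have fA: "f x \<in> A" if "x \<in> mspace X" for x using f(1) that by auto
    show "(h \<circ> f) ` mspace X = mspace (submetric Z' (h ` A))"
      using f(1) by (auto simp: Z' image_comp[symmetric])
    show "mdist (submetric Z' (h ` A)) ((h \<circ> f) x) ((h \<circ> f) x') = mdist X x x'"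
      if "x \<in> mspace X" "x' \<in> mspace X" for x x'
      using that f(2) fA by (simp add: Z' kh)
  qed
  have iso2: "isometric_metrics Y (submetric Z' (h ` B))"
    unfolding isometric_metrics_def
  proof (intro exI[of _ "h \<circ> g"] conjI ballI)
    have gB: "g x \<in> B" if "x \<in> mspace Y" for x using g(1) that by auto
    show "(h \<circ> g) ` mspace Y = mspace (submetric Z' (h ` B))"
      using g(1) by (auto simp: Z' image_comp[symmetric])
    show "mdist (submetric Z' (h ` B)) ((h \<circ> g) x) ((h \<circ> g) x') = mdist Y x x'"
      if "x \<in> mspace Y" "x' \<in> mspace Y" for x x'
      using that g(2) gB by (simp add: Z' kh)
  qed
  have "Hausdorff_dist Z' (h ` A) (h ` B) = Hausdorff_dist Z A B"
    unfolding Hausdorff_dist_def image_image Z'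
    by (intro arg_cong2[where f = max] SUP_cong INF_cong refl) (simp_all add: kh)
  then have "Hausdorff_dist Z' (h ` A) (h ` B) \<le> ennreal r"
    using real by simp
  moreover have "h ` A \<subseteq> mspace Z'" "h ` B \<subseteq> mspace Z'"
    by (auto simp: Z')
  ultimately have "GH_dist X Y \<le> ennreal r"
    unfolding GH_dist_def using iso1 iso2 real(1) by (intro Inf_lower) blast
  then show ?thesis using real by simp
qed

end

theory Submission
  imports Defs
begin

text \<open>
  A ball of radius less than \<open>1/2\<close> contains no two points at distance at least \<open>1\<close>. So if the
  two lattices lie in a common metric space at Hausdorff distance less than \<open>1/2\<close>, moving each
  point of \<open>\<int>\<^sup>n\<close> to a nearby point of \<open>\<lambda>\<int>\<^sup>n\<close> is injective, and it changes distances by less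
  than \<open>1\<close>. Rescaling the target by \<open>1/\<lambda>\<close> gives an injective map of \<open>\<int>\<^sup>n\<close> to itself that
  shrinks large distances by a factor close to \<open>\<lambda>\<close>. Counting lattice points rules such a map out
  (\<open>no_injective_lattice_contraction\<close>): after a translation it carries, for large \<open>k\<close>, the
  finitely many lattice points of norm at most \<open>k\<close> injectively into a proper subset of them.
\<close>

lemma one_le_dist_integer_vectors:
  fixes x y :: "real ^ 'n"
  assumes "\<forall>i. x $ i \<in> \<int>" "\<forall>i. y $ i \<in> \<int>" "x \<noteq> y"
  shows "1 \<le> dist x y"
proof -
  obtain i where "x $ i \<noteq> y $ i"
    using \<open>x \<noteq> y\<close> by (auto simp: vec_eq_iff)
  then have "1 \<le> \<bar>x $ i - y $ i\<bar>"
    using assms by (intro Ints_nonzero_abs_ge1) auto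
  also have "\<dots> \<le> dist x y"
    using dist_vec_nth_le[of x i y] by (simp add: dist_real_def)
  finally show ?thesis .
qed

lemma finite_integer_vectors_norm_le:
  "finite {x :: real ^ 'n. (\<forall>i. x $ i \<in> \<int>) \<and> norm x \<le> r}"
proof -
  let ?S = "{x :: real ^ 'n. (\<forall>i. x $ i \<in> \<int>) \<and> norm x \<le> r}"
  have "uniform_discrete ?S"
    unfolding uniform_discrete_def using one_le_dist_integer_vectors
    by (intro exI[of _ 1]) fastforce
  moreover have "bounded ?S"
    unfolding bounded_iff by blast
  ultimately show ?thesis
    by (simp flip: uniform_discrete_finite_iff)
qed

text \<open>
  For large \<open>k\<close> the map, translated to fix the origin, sends the integer vectors of norm at most
  \<open>k\<close> to integer vectors of norm at most \<open>(k + C) / c < k\<close>. The latter form a finite set that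
  misses \<open>k\<close> times a coordinate vector, so it has strictly fewer elements.
\<close>

lemma no_injective_lattice_contraction:
  fixes h :: "real ^ 'n \<Rightarrow> real ^ 'n" and c C :: real
  defines "L \<equiv> {x :: real ^ 'n. \<forall>i. x $ i \<in> \<int>}"
  assumes "1 < c" and h: "h ` L \<subseteq> L" and inj: "inj_on h L"
    and contr: "\<And>x y. x \<in> L \<Longrightarrow> y \<in> L \<Longrightarrow> c * dist (h x) (h y) \<le> dist x y + C"
  shows False
proof -
  obtain k :: nat where "C / (c - 1) < k"
    using reals_Archimedean2 by blast
  then have k: "(k + C) / c < k"
    using \<open>1 < c\<close> by (simp add: field_simps)
  define B where "B r = {x \<in> L. norm x \<le> r}" for r
  have fin: "finite (B r)" for r
    using finite_integer_vectors_norm_le[of r] by (simp add: B_def L_def)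
  have zero: "0 \<in> L"
    by (simp add: L_def)
  have "(\<lambda>x. h x - h 0) ` B k \<subseteq> B ((k + C) / c)"
  proof safe
    fix x assume "x \<in> B k"
    then have x: "x \<in> L" "norm x \<le> k"
      by (auto simp: B_def)
    have "c * norm (h x - h 0) \<le> k + C"
      using contr[OF x(1) zero] x(2) by (simp add: dist_norm)
    moreover have "h x \<in> L" "h 0 \<in> L"
      using h x(1) zero by blast+
    then have "h x - h 0 \<in> L"
      by (simp add: L_def)
    ultimately show "h x - h 0 \<in> B ((k + C) / c)"
      using \<open>1 < c\<close> by (simp add: B_def field_simps)
  qed
  moreover have "inj_on (\<lambda>x. h x - h 0) (B k)"
    using inj by (auto simp: inj_on_def B_def)
  ultimately have "card (B k) \<le> card (B ((k + C) / c))"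
    using fin by (metis card_inj_on_le)
  moreover have "B ((k + C) / c) \<subset> B k"
  proof
    show "B ((k + C) / c) \<subseteq> B k"
      using k by (auto simp: B_def)
    have "real k *\<^sub>R axis i 1 \<in> B k - B ((k + C) / c)" for i
    proof -
      have "real k *\<^sub>R axis i 1 \<in> L"
        by (simp add: L_def axis_def)
      then show ?thesis
        using k by (simp add: B_def norm_axis_1)
    qed
    then show "B ((k + C) / c) \<noteq> B k"
      by blast
  qed
  ultimately show False
    using psubset_card_mono[OF fin] by (meson not_le)
qed

theorem theorem5:
  fixes lam :: real
  assumes "lam > 1"
  shows "GH_dist (integer_lattice :: (real ^ 'n) metric)
                 (scale_metric lam (integer_lattice :: (real ^ 'n) metric)) \<ge> ennreal (1 / 2)"
proof (rule ccontr)
  define L where "L = {x :: real ^ 'n. \<forall>i. x $ i \<in> \<int>}"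
  have lam: "lam > 0"
    using assms by simp
  assume "\<not> ?thesis"
  then obtain r and Z :: "(real ^ 'n + real ^ 'n) metric" and X' Y' where
      r: "ennreal r < ennreal (1 / 2)"
      and sub: "X' \<subseteq> mspace Z" "Y' \<subseteq> mspace Z"
      and iso: "isometric_metrics (integer_lattice :: (real ^ 'n) metric) (submetric Z X')"
        "isometric_metrics (scale_metric lam (integer_lattice :: (real ^ 'n) metric))
           (submetric Z Y')"
      and haus: "Hausdorff_dist Z X' Y' \<le> ennreal r"
    unfolding GH_dist_def not_le Inf_less_iff by blast
  have ms: "mspace (submetric Z X') = X'" "mspace (submetric Z Y') = Y'"
    using sub by auto
  obtain F where F: "F ` L = X'"
      "\<And>x y. x \<in> L \<Longrightarrow> y \<in> L \<Longrightarrow> mdist Z (F x) (F y) = dist x y"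
    using iso(1) unfolding isometric_metrics_def ms
    by (auto simp: mspace_integer_lattice mdist_integer_lattice L_def)
  obtain G where G: "G ` L = Y'"
      "\<And>x y. x \<in> L \<Longrightarrow> y \<in> L \<Longrightarrow> mdist Z (G x) (G y) = lam * dist x y"
    using iso(2) unfolding isometric_metrics_def ms
    by (auto simp: mspace_scale_metric mdist_scale_metric lam
        mspace_integer_lattice mdist_integer_lattice L_def)
  have "\<exists>y\<in>L. mdist Z (F x) (G y) < 1 / 2" if "x \<in> L" for x
  proof -
    \<comment> \<open>The infimum over \<open>Y'\<close> need not be attained; the strict bound by \<open>1/2\<close> still yields a point.\<close>
    have "F x \<in> X'"
      using F(1) that by blast
    then have "(INF b\<in>Y'. ennreal (mdist Z (F x) b)) \<le> (SUP a\<in>X'. INF b\<in>Y'. ennreal (mdist Z a b))"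
      by (rule SUP_upper)
    also have "\<dots> \<le> Hausdorff_dist Z X' Y'"
      by (simp add: Hausdorff_dist_def)
    also have "\<dots> < ennreal (1 / 2)"
      using haus r by (rule le_less_trans)
    finally obtain y where "y \<in> L" "ennreal (mdist Z (F x) (G y)) < ennreal (1 / 2)"
      unfolding INF_less_iff G(1)[symmetric] by blast
    then show ?thesis
      by (subst (asm) ennreal_less_iff) auto
  qed
  then obtain h where h: "\<And>x. x \<in> L \<Longrightarrow> h x \<in> L"
      "\<And>x. x \<in> L \<Longrightarrow> mdist Z (F x) (G (h x)) < 1 / 2"
    by metis
  have in_Z: "F x \<in> mspace Z" "G x \<in> mspace Z" if "x \<in> L" for x
    using that F(1) G(1) sub by auto
  have "inj_on h L"
  proof (rule inj_onI, rule ccontr)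
    fix x y assume xy: "x \<in> L" "y \<in> L" "h x = h y" "x \<noteq> y"
    have "dist x y \<le> mdist Z (F x) (G (h x)) + mdist Z (G (h x)) (F y)"
      using mdist_triangle[of "F x" Z "G (h x)" "F y"] F(2) in_Z h(1) xy by simp
    also have "\<dots> < 1"
      using h(2)[of x] h(2)[of y] xy by (simp add: mdist_commute)
    finally show False
      using one_le_dist_integer_vectors[of x y] xy by (simp add: L_def)
  qed
  moreover have "lam * dist (h x) (h y) \<le> dist x y + 1" if "x \<in> L" "y \<in> L" for x y
  proof -
    have "lam * dist (h x) (h y) = mdist Z (G (h x)) (G (h y))"
      using G(2) h(1) that by simp
    also have "\<dots> \<le> mdist Z (F x) (G (h x)) + mdist Z (F x) (G (h y))"
      using mdist_triangle[of "G (h x)" Z "F x" "G (h y)"] in_Z h(1) that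
      by (simp add: mdist_commute)
    also have "mdist Z (F x) (G (h y)) \<le> mdist Z (F x) (F y) + mdist Z (F y) (G (h y))"
      using mdist_triangle[of "F x" Z "F y" "G (h y)"] in_Z h(1) that by simp
    finally show ?thesis
      using h(2)[of x] h(2)[of y] F(2) that by simp
  qed
  ultimately show False
    using no_injective_lattice_contraction[of lam h 1] assms h(1) unfolding L_def by blast
qed

end
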